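(* Let $(\Omega,I)$, with $\Omega=\bigcup_{i=1}^f\Omega_i$ and $I=\bigcup_{i\ne j}I_{i,j}$, be a linked system of symmetric $(v,k,\lambda)$ designs, put $n=k-\lambda$, and let $\sigma,\tau$ be the integers such that for distinct $i,j,l\in\{1,\dots,f\}$ and $x\in\Omega_i$, $y\in\Omega_j$, $$|\{z\in\Omega_l\mid(x,z)\in I_{i,l},\ (y,z)\in I_{j,l}\}|=\begin{cases}\sigma&\text{if }(x,y)\in I_{i,j},\\ \tau&\text{if }(x,y)\notin I_{i,j}.\end{cases}$$ Assume that $$\sigma=\frac1v\big(k^2-\sqrt n\,(v-k)\big),\qquad\tau=\frac kv\big(k+\sqrt n\big),$$ and that $$f=1+\frac{(v-2)\sqrt{k(v-k)}}{(v-2k)\sqrt{v-1}}.$$ Define $$R_0=\{(x,x)\mid x\in\Omega\},\qquad R_1=\{(x,y)\mid x\in\Omega_i,\ y\in\Omega_j,\ (x,y)\in I_{i,j}\text{ for some }i\neq j\},$$ $$R_2=\{(x,y)\mid x,y\in\Omega_i,\ x\ne y\text{ for some }i\},\qquad R_3=\{(x,y)\mid x\in\Omega_i,\ y\in\Omega_j,\ (x,y)\notin I_{i,j}\text{ for some }i\ne j\}.$$ Then $(\Omega,\{R_i\}_{i=0}^3)$ is a triply regular association scheme.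
   Context: Linked system of symmetric $(v,k,\lambda)$ designs: for distinct $i,j\in\{1,\dots,f\}$ let $(\Omega_i,\Omega_j,I_{i,j})$ be incidence structures with $\Omega_i\cap\Omega_j=\emptyset$ and $I_{j,i}=\{(y,x)\mid(x,y)\in I_{i,j}\}$. Put $\Omega=\bigcup_i\Omega_i$, $I=\bigcup_{i\neq j}I_{i,j}$. Then $(\Omega,I)$ is a linked system of symmetric $(v,k,\lambda)$ designs if (1) for any distinct $i,j$, $(\Omega_i,\Omega_j,I_{i,j})$ is a symmetric $(v,k,\lambda)$ design; (2) for any distinct $i,j,l$ and any $x\in\Omega_i$, $y\in\Omega_j$, the number of $z\in\Omega_l$ incident with both $x$ and $y$ depends only on whether $x$ and $y$ are incident or not, and does not depend on $i,j,l$. Symmetric association scheme: a finite set $X$ with a partition $\{R_k\}_{k=0}^s$ of $X\times X$ into symmetric relations, $R_0$ being the diagonal, such that for all $i,j,k$ the number $|\{w\in X\mid(x,w)\in R_i,(w,y)\in R_j\}|$ is independent of the choice of $(x,y)\in R_k$. A symmetric association scheme is triply regular if for all $i,j,k,l,m,n\in\{0,\dots,s\}$ and all $x,y,z\in X$ with $(x,y)\in R_i$, $(y,z)\in R_j$, $(z,x)\in R_k$, the number $|\{w\in X\mid(w,x)\in R_m,(w,y)\in R_n,(w,z)\in R_l\}|$ depends only on $i,j,k,l,m,n$ and not on $x,y,z$. *)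

theory Defs
  imports Complex_Main "HOL-Library.Disjoint_Sets"
begin

(* A 2-(v,k,l) design with as many blocks as points. The point set is nonempty,
   so k <= v; no further nondegeneracy of the parameters is required. That every
   point lies on k blocks and two distinct blocks meet in l points is not part of
   the definition; in a linked system it is the same condition for the transposed
   design. *)
definition symmetric_design ::
  "'a set \<Rightarrow> 'b set \<Rightarrow> ('a \<times> 'b) set \<Rightarrow> nat \<Rightarrow> nat \<Rightarrow> nat \<Rightarrow> bool" where
  "symmetric_design P B I v k l \<longleftrightarrow>
     finite P \<and> P \<noteq> {} \<and> finite B \<and> I \<subseteq> P \<times> B \<and>
     card P = v \<and> card B = v \<and>
     (\<forall>b\<in>B. card {p\<in>P. (p, b) \<in> I} = k) \<and>
     (\<forall>p\<in>P. \<forall>q\<in>P. p \<noteq> q \<longrightarrow> card {b\<in>B. (p, b) \<in> I \<and> (q, b) \<in> I} = l)"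

(* Only the values of Om on {1..f}, and of I on pairs of distinct elements of
   {1..f}, are relevant. *)
definition linked_system ::
  "nat \<Rightarrow> (nat \<Rightarrow> 'a set) \<Rightarrow> (nat \<Rightarrow> nat \<Rightarrow> ('a \<times> 'a) set) \<Rightarrow> nat \<Rightarrow> nat \<Rightarrow> nat \<Rightarrow> bool" where
  "linked_system f Om I v k l \<longleftrightarrow>
     (\<forall>i\<in>{1..f}. \<forall>j\<in>{1..f}. i \<noteq> j \<longrightarrow>
        Om i \<inter> Om j = {} \<and> I j i = (I i j)\<inverse> \<and>
        symmetric_design (Om i) (Om j) (I i j) v k l) \<and>
     (\<exists>s t. \<forall>i\<in>{1..f}. \<forall>j\<in>{1..f}. \<forall>h\<in>{1..f}. i \<noteq> j \<longrightarrow> j \<noteq> h \<longrightarrow> i \<noteq> h \<longrightarrow>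
        (\<forall>x\<in>Om i. \<forall>y\<in>Om j.
           card {z\<in>Om h. (x, z) \<in> I i h \<and> (y, z) \<in> I j h} =
             (if (x, y) \<in> I i j then s else t)))"

(* The classes are R 0, ..., R s; as members of a partition they are nonempty,
   so X is nonempty as well. *)
definition symmetric_association_scheme ::
  "'a set \<Rightarrow> nat \<Rightarrow> (nat \<Rightarrow> ('a \<times> 'a) set) \<Rightarrow> bool" where
  "symmetric_association_scheme X s R \<longleftrightarrow>
     finite X \<and>
     partition_on (X \<times> X) (R ` {..s}) \<and> inj_on R {..s} \<and>
     R 0 = Id_on X \<and>
     (\<forall>i\<le>s. sym (R i)) \<and>
     (\<forall>i\<le>s. \<forall>j\<le>s. \<forall>k\<le>s. \<exists>p. \<forall>x y. (x, y) \<in> R k \<longrightarrow>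
        card {w\<in>X. (x, w) \<in> R i \<and> (w, y) \<in> R j} = p)"

definition triply_regular_scheme ::
  "'a set \<Rightarrow> nat \<Rightarrow> (nat \<Rightarrow> ('a \<times> 'a) set) \<Rightarrow> bool" where
  "triply_regular_scheme X s R \<longleftrightarrow>
     symmetric_association_scheme X s R \<and>
     (\<forall>i\<le>s. \<forall>j\<le>s. \<forall>k\<le>s. \<forall>l\<le>s. \<forall>m\<le>s. \<forall>n\<le>s. \<exists>c.
        \<forall>x\<in>X. \<forall>y\<in>X. \<forall>z\<in>X. (x, y) \<in> R i \<longrightarrow> (y, z) \<in> R j \<longrightarrow> (z, x) \<in> R k \<longrightarrow>
          card {w\<in>X. (w, x) \<in> R m \<and> (w, y) \<in> R n \<and> (w, z) \<in> R l} = c)"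

end

theory Submission
  imports Defs
begin

text \<open>
  The linked system is turned into a configuration of vectors: each fibre becomes a regular
  simplex, and the hypotheses on \<open>\<sigma>\<close>, \<open>\<tau>\<close> and \<open>f\<close> say that the union of the simplices is a
  spherical 3-design. Only the Gram matrix \<open>G\<close> of these vectors is needed. Its entries are
  \<open>\<delta>\<^sub>x\<^sub>y - 1/v\<close> when \<open>x\<close> and \<open>y\<close> lie in the same fibre, and \<open>(k/v - N\<^sub>x\<^sub>y)/\<surd>n\<close> otherwise, where \<open>N\<close> is
  the incidence matrix.

  The design axioms together with the values of \<open>\<sigma>\<close> and \<open>\<tau>\<close> translate into the relations
  \<open>\<Sum>\<^sub>w G\<^sub>w\<^sub>y = 0\<close> and \<open>\<Sum>\<^sub>w G\<^sub>w\<^sub>x G\<^sub>w\<^sub>y = G\<^sub>x\<^sub>y\<close>, where \<open>w\<close> runs over a single fibre, whichever one it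
  is (\<open>sum_gram_fibre\<close>, \<open>sum_gram_gram\<close>). The value of \<open>f\<close> is the one for which \<open>\<Sum>\<^sub>x\<^sub>y G\<^sub>x\<^sub>y\<^sup>3\<close>
  vanishes (\<open>sum_cubes\<close>): the simplex through a vector contributes a positive amount to this sum
  and every other simplex a fixed negative one. That sum is, up to the factor \<open>f\<^sup>3\<close>, the sum of
  the squares of the third moments \<open>T(x,y,z) = \<Sum>\<^sub>w G\<^sub>w\<^sub>x G\<^sub>w\<^sub>y G\<^sub>w\<^sub>z\<close>, with \<open>w\<close> in \<open>\<Omega>\<close>; hence every
  third moment is zero (\<open>third_moment_zero\<close>).

  The indicator functions of the four classes are linear combinations of the constant
  function, the diagonal, the same-fibre indicator and \<open>G\<close>. A number of points \<open>w\<close> in prescribed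
  relations to \<open>x\<close>, \<open>y\<close>, \<open>z\<close> is therefore a combination of sums over \<open>w\<close> of products of three of
  these functions. A diagonal factor collapses such a sum to one term, a same-fibre factor
  restricts it to one fibre, where the two fibre relations evaluate it, and what is left are
  the moments of \<open>G\<close> over \<open>\<Omega>\<close> of order at most three. All values depend on the mutual relations of
  \<open>x\<close>, \<open>y\<close>, \<open>z\<close> only (\<open>triple_sum_class_function\<close>), which is triple regularity. The intersection
  numbers of the scheme are the case \<open>z = y\<close>.
\<close>

section \<open>Triple sums in linked tight frames\<close>

text \<open>
  \<open>G\<close> is to be read as the Gram matrix of vectors grouped into fibres. The second and third
  conditions on \<open>G\<close> say that the vectors of each fibre sum to zero and form a tight frame, with
  frame constant 1, of the space that they span, which is the same for all fibres. The last
  condition is what makes the third moments of the whole configuration vanish.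
\<close>
locale linked_frames =
  fixes J :: "'i set" and v :: nat and Om :: "'i \<Rightarrow> 'a set" and G :: "'a \<Rightarrow> 'a \<Rightarrow> real"
  assumes finite_J: "finite J"
    and finite_fibre: "i \<in> J \<Longrightarrow> finite (Om i)"
    and disjoint_fibres: "\<lbrakk>i \<in> J; j \<in> J; i \<noteq> j\<rbrakk> \<Longrightarrow> Om i \<inter> Om j = {}"
    and card_fibre: "i \<in> J \<Longrightarrow> card (Om i) = v"
    and gram_sym: "G x y = G y x"
    and gram_fibre_sum: "\<lbrakk>i \<in> J; j \<in> J; y \<in> Om j\<rbrakk> \<Longrightarrow> (\<Sum>w\<in>Om i. G w y) = 0"
    and gram_reproducing: "\<lbrakk>h \<in> J; i \<in> J; j \<in> J; x \<in> Om i; y \<in> Om j\<rbrakk> \<Longrightarrow>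
      (\<Sum>w\<in>Om h. G w x * G w y) = G x y"
    and gram_cube_sum: "(\<Sum>x\<in>(\<Union>i\<in>J. Om i). \<Sum>y\<in>(\<Union>i\<in>J. Om i). G x y ^ 3) = 0"
begin

abbreviation X :: "'a set" where "X \<equiv> \<Union>i\<in>J. Om i"

definition cofibre :: "'a \<Rightarrow> 'a \<Rightarrow> bool" where
  "cofibre x y \<longleftrightarrow> (\<exists>i\<in>J. x \<in> Om i \<and> y \<in> Om i)"

lemma finite_X: "finite X"
  using finite_J finite_fibre by blast

lemma sum_X: "(\<Sum>w\<in>X. g w) = (\<Sum>i\<in>J. \<Sum>w\<in>Om i. g w)"
  by (rule sum.UNION_disjoint[OF finite_J]) (use finite_fibre disjoint_fibres in auto)

lemma cofibre_sym: "cofibre x y \<longleftrightarrow> cofibre y x"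
  unfolding cofibre_def by blast

lemma cofibre_iff: "\<lbrakk>i \<in> J; x \<in> Om i\<rbrakk> \<Longrightarrow> cofibre w x \<longleftrightarrow> w \<in> Om i"
  using disjoint_fibres unfolding cofibre_def by blast

lemma gram_sum:
  assumes "y \<in> X"
  shows "(\<Sum>w\<in>X. G w y) = 0"
proof -
  have "(\<Sum>w\<in>Om i. G w y) = 0" if "i \<in> J" for i
    using gram_fibre_sum that assms by blast
  then show ?thesis by (simp add: sum_X)
qed

lemma gram_square:
  assumes "x \<in> X" "y \<in> X"
  shows "(\<Sum>w\<in>X. G w x * G w y) = card J * G x y"
proof -
  have "(\<Sum>w\<in>Om i. G w x * G w y) = G x y" if "i \<in> J" for i
    using gram_reproducing that assms by blast
  then show ?thesis by (simp add: sum_X)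
qed

lemma gram_square_row:
  assumes "w \<in> X" "u \<in> X"
  shows "(\<Sum>x\<in>X. G w x * G u x) = card J * G w u"
  unfolding gram_square[OF assms, symmetric] by (intro sum.cong refl arg_cong2[where f="(*)"] gram_sym)

text \<open>
  The sum of the squares of all third moments is \<open>card J ^ 3\<close> times \<open>\<Sum>\<^sub>w\<^sub>u G\<^sub>w\<^sub>u\<^sup>3\<close>: after expanding
  each square as a sum over two points \<open>w\<close>, \<open>u\<close>, the sums over the three arguments separate and
  each of them equals \<open>card J * G w u\<close>.
\<close>
lemma third_moment_zero:
  assumes "x \<in> X" "y \<in> X" "z \<in> X"
  shows "(\<Sum>w\<in>X. G w x * G w y * G w z) = 0"
proof -
  \<comment> \<open>the triple of arguments is one summation index, so that one exchange of summations per point suffices\<close>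
  define g where "g w = (\<lambda>(x, y, z). G w x * G w y * G w z)" for w
  define Q where "Q = X \<times> X \<times> X"
  have fin: "finite Q"
    unfolding Q_def using finite_X by blast
  have inner: "(\<Sum>p\<in>Q. g w p * g u p) = (card J * G w u) ^ 3" if "w \<in> X" "u \<in> X" for w u
  proof -
    have "(card J * G w u) ^ 3 = (\<Sum>x\<in>X. G w x * G u x) * ((\<Sum>y\<in>X. G w y * G u y) * (\<Sum>z\<in>X. G w z * G u z))"
      unfolding gram_square_row[OF that] by (simp add: power3_eq_cube)
    also have "\<dots> = (\<Sum>p\<in>Q. g w p * g u p)"
      unfolding sum_product sum.cartesian_product Q_def
      by (simp add: sum_product sum.cartesian_product g_def case_prod_unfold mult_ac)
    finally show ?thesis by simp
  qed
  have "(\<Sum>p\<in>Q. (\<Sum>w\<in>X. g w p)\<^sup>2) = (\<Sum>p\<in>Q. \<Sum>w\<in>X. \<Sum>u\<in>X. g w p * g u p)"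
    by (simp add: power2_eq_square sum_product)
  also have "\<dots> = (\<Sum>w\<in>X. \<Sum>p\<in>Q. \<Sum>u\<in>X. g w p * g u p)"
    by (rule sum.swap)
  also have "\<dots> = (\<Sum>w\<in>X. \<Sum>u\<in>X. \<Sum>p\<in>Q. g w p * g u p)"
    by (rule sum.cong[OF refl], rule sum.swap)
  also have "\<dots> = (\<Sum>w\<in>X. \<Sum>u\<in>X. (card J * G w u) ^ 3)"
    by (intro sum.cong refl inner)
  also have "\<dots> = card J ^ 3 * (\<Sum>w\<in>X. \<Sum>u\<in>X. G w u ^ 3)"
    by (simp add: power_mult_distrib sum_distrib_left)
  finally have "(\<Sum>p\<in>Q. (\<Sum>w\<in>X. g w p)\<^sup>2) = 0"
    by (simp only: gram_cube_sum mult_zero_right)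
  then have "\<forall>p\<in>Q. (\<Sum>w\<in>X. g w p) = 0"
    using sum_nonneg_eq_0_iff[OF fin, of "\<lambda>p. (\<Sum>w\<in>X. g w p)\<^sup>2"] by simp
  then have "(\<Sum>w\<in>X. g w (x, y, z)) = 0"
    using assms unfolding Q_def by blast
  then show ?thesis
    by (simp add: g_def)
qed

definition triple_sum ::
  "('a \<Rightarrow> 'a \<Rightarrow> real) \<Rightarrow> ('a \<Rightarrow> 'a \<Rightarrow> real) \<Rightarrow> ('a \<Rightarrow> 'a \<Rightarrow> real) \<Rightarrow> 'a \<Rightarrow> 'a \<Rightarrow> 'a \<Rightarrow> real" where
  "triple_sum P Q S x y z = (\<Sum>w\<in>X. P w x * Q w y * S w z)"

lemma triple_sum_swap12: "triple_sum P Q S x y z = triple_sum Q P S y x z"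
  by (simp add: triple_sum_def mult_ac)

lemma triple_sum_swap13: "triple_sum P Q S x y z = triple_sum S Q P z y x"
  by (simp add: triple_sum_def mult_ac)

text \<open>
  Together with \<open>G\<close>, the next three functions span all the functions of a pair of points that
  are needed.
\<close>
definition "cst_fun = (\<lambda>x y :: 'a. 1 :: real)"
definition "delta = (\<lambda>x y :: 'a. of_bool (x = y) :: real)"
definition "cofib = (\<lambda>x y :: 'a. of_bool (cofibre x y) :: real)"

text \<open>
  Two pairs have the same type if no function of the span separates them. Membership in \<open>X\<close> is
  included because the sum formulas hold there only.
\<close>
definition same_type :: "'a \<Rightarrow> 'a \<Rightarrow> 'a \<Rightarrow> 'a \<Rightarrow> bool" where
  "same_type x y x' y' \<longleftrightarrow>
     x \<in> X \<and> y \<in> X \<and> x' \<in> X \<and> y' \<in> X \<and>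
     (x = y \<longleftrightarrow> x' = y') \<and> (cofibre x y \<longleftrightarrow> cofibre x' y') \<and> G x y = G x' y'"

lemma same_type_sym: "same_type x y x' y' \<Longrightarrow> same_type y x y' x'"
  by (auto simp: same_type_def cofibre_sym gram_sym)

definition same_triple :: "'a \<Rightarrow> 'a \<Rightarrow> 'a \<Rightarrow> 'a \<Rightarrow> 'a \<Rightarrow> 'a \<Rightarrow> bool" where
  "same_triple x y z x' y' z' \<longleftrightarrow>
     same_type x y x' y' \<and> same_type y z y' z' \<and> same_type x z x' z'"

lemma same_triple_swap12: "same_triple x y z x' y' z' \<Longrightarrow> same_triple y x z y' x' z'"
  by (simp add: same_triple_def same_type_sym)

lemma same_triple_swap13: "same_triple x y z x' y' z' \<Longrightarrow> same_triple z y x z' y' x'"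
  by (simp add: same_triple_def same_type_sym)

lemma basis_same_type:
  "\<lbrakk>same_type x y x' y'; P \<in> {cst_fun, delta, cofib, G}\<rbrakk> \<Longrightarrow> P x y = P x' y'"
  by (auto simp: same_type_def cst_fun_def delta_def cofib_def)

lemma triple_sum_delta:
  assumes "x \<in> X" shows "triple_sum delta Q S x y z = Q x y * S x z"
proof -
  have "triple_sum delta Q S x y z = (\<Sum>w\<in>X. if w = x then Q w y * S w z else 0)"
    unfolding triple_sum_def delta_def by (intro sum.cong) auto
  then show ?thesis
    using assms finite_X by simp
qed

lemma triple_sum_cofib:
  assumes "i \<in> J" "x \<in> Om i"
  shows "triple_sum cofib Q S x y z = (\<Sum>w\<in>Om i. Q w y * S w z)"
proof -
  have "triple_sum cofib Q S x y z = (\<Sum>w\<in>X. if w \<in> Om i then Q w y * S w z else 0)"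
    unfolding triple_sum_def cofib_def by (intro sum.cong) (auto simp: cofibre_iff[OF assms])
  also have "\<dots> = (\<Sum>w\<in>X \<inter> Om i. Q w y * S w z)"
    by (rule sum.inter_restrict[symmetric, OF finite_X])
  also have "X \<inter> Om i = Om i" using assms by blast
  finally show ?thesis .
qed

lemma triple_sum_delta_same_triple:
  assumes "same_triple x y z x' y' z'" "Q \<in> {cst_fun, delta, cofib, G}" "S \<in> {cst_fun, delta, cofib, G}"
  shows "triple_sum delta Q S x y z = triple_sum delta Q S x' y' z'"
proof -
  have "x \<in> X" "x' \<in> X" using assms(1) by (auto simp: same_triple_def same_type_def)
  moreover have "Q x y = Q x' y'" "S x z = S x' z'"
    using assms basis_same_type unfolding same_triple_def by blast+
  ultimately show ?thesis by (simp add: triple_sum_delta)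
qed

text \<open>
  The first factor confines \<open>w\<close> to the fibre of \<open>x\<close>. There a same-fibre factor in \<open>y\<close> or \<open>z\<close> is
  constant, and the rest is a moment of \<open>G\<close> of order at most two over a single fibre.
\<close>
lemma triple_sum_cofib_value:
  assumes X: "x \<in> X" "y \<in> X" "z \<in> X"
  shows "triple_sum cofib cst_fun cst_fun x y z = v"
    "triple_sum cofib cst_fun cofib x y z = v * cofib x z"
    "triple_sum cofib cofib cst_fun x y z = v * cofib x y"
    "triple_sum cofib cofib cofib x y z = v * cofib x y * cofib x z"
    "triple_sum cofib cst_fun G x y z = 0"
    "triple_sum cofib G cst_fun x y z = 0"
    "triple_sum cofib cofib G x y z = 0"
    "triple_sum cofib G cofib x y z = 0"
    "triple_sum cofib G G x y z = G y z"
proof -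
  obtain i where i: "i \<in> J" "x \<in> Om i" using X by blast
  have c: "cofib w u = cofib x u" if "w \<in> Om i" for w u
    unfolding cofib_def cofibre_sym[of w u] cofibre_sym[of x u]
    using cofibre_iff[OF i(1) that, of u] cofibre_iff[OF i, of u] by simp
  have s: "(\<Sum>w\<in>Om i. G w u) = 0" if "u \<in> X" for u
    using gram_fibre_sum i that by blast
  note [simp] = triple_sum_cofib[OF i] cst_fun_def card_fibre[OF i(1)] s[OF X(2)] s[OF X(3)]
  have cy: "cofib w y = cofib x y" and cz: "cofib w z = cofib x z" if "w \<in> Om i" for w
    using c[OF that] by blast+
  show "triple_sum cofib cst_fun cst_fun x y z = v" by simp
  show "triple_sum cofib cst_fun cofib x y z = v * cofib x z" by (simp add: cz)
  show "triple_sum cofib cofib cst_fun x y z = v * cofib x y" by (simp add: cy)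
  show "triple_sum cofib cofib cofib x y z = v * cofib x y * cofib x z" by (simp add: cy cz)
  show "triple_sum cofib cst_fun G x y z = 0" by simp
  show "triple_sum cofib G cst_fun x y z = 0" by simp
  show "triple_sum cofib cofib G x y z = 0" by (simp add: cy flip: sum_distrib_left)
  show "triple_sum cofib G cofib x y z = 0" by (simp add: cz flip: sum_distrib_right)
  show "triple_sum cofib G G x y z = G y z" using gram_reproducing i X by auto
qed

lemma triple_sum_cofib_same_triple:
  assumes st: "same_triple x y z x' y' z'" and QS: "Q \<in> {cst_fun, cofib, G}" "S \<in> {cst_fun, cofib, G}"
  shows "triple_sum cofib Q S x y z = triple_sum cofib Q S x' y' z'"
proof -
  have X: "x \<in> X" "y \<in> X" "z \<in> X" and X': "x' \<in> X" "y' \<in> X" "z' \<in> X"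
    using st by (auto simp: same_triple_def same_type_def)
  have "cofib x y = cofib x' y'" "cofib x z = cofib x' z'" "G y z = G y' z'"
    using st unfolding same_triple_def by (auto intro: basis_same_type)
  then show ?thesis
    using QS by (auto simp: triple_sum_cofib_value[OF X] triple_sum_cofib_value[OF X'])
qed

text \<open>
  These are the moments of \<open>G\<close> over the whole point set. The only one of order three vanishes
  by \<open>third_moment_zero\<close>.
\<close>
lemma triple_sum_gram_same_triple:
  assumes st: "same_triple x y z x' y' z'" and PQS: "P \<in> {cst_fun, G}" "Q \<in> {cst_fun, G}" "S \<in> {cst_fun, G}"
  shows "triple_sum P Q S x y z = triple_sum P Q S x' y' z'"
proof -
  have X: "x \<in> X" "y \<in> X" "z \<in> X" and X': "x' \<in> X" "y' \<in> X" "z' \<in> X"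
    using st by (auto simp: same_triple_def same_type_def)
  have "G x y = G x' y'" "G x z = G x' z'" "G y z = G y' z'"
    using st unfolding same_triple_def by (auto intro: basis_same_type)
  then show ?thesis
    using PQS X X'
    by (elim insertE emptyE)
       (simp_all add: triple_sum_def cst_fun_def gram_sum gram_square third_moment_zero)
qed

text \<open>
  Permuting the three factors and the three points simultaneously does not change the sum, so a
  diagonal or same-fibre factor may be assumed to come first.
\<close>
lemma triple_sum_basis:
  assumes st: "same_triple x y z x' y' z'"
    and "P \<in> {cst_fun, delta, cofib, G}" "Q \<in> {cst_fun, delta, cofib, G}" "S \<in> {cst_fun, delta, cofib, G}"
  shows "triple_sum P Q S x y z = triple_sum P Q S x' y' z'"
proof -
  note st12 = same_triple_swap12[OF st] and st13 = same_triple_swap13[OF st]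
  consider "P = delta" | "Q = delta" | "S = delta"
    | "P = cofib" "Q \<in> {cst_fun, cofib, G}" "S \<in> {cst_fun, cofib, G}"
    | "Q = cofib" "P \<in> {cst_fun, cofib, G}" "S \<in> {cst_fun, cofib, G}"
    | "S = cofib" "P \<in> {cst_fun, cofib, G}" "Q \<in> {cst_fun, cofib, G}"
    | "P \<in> {cst_fun, G}" "Q \<in> {cst_fun, G}" "S \<in> {cst_fun, G}"
    using assms by blast
  then show ?thesis
  proof cases
    case 1 then show ?thesis using triple_sum_delta_same_triple[OF st] assms by blast
  next
    case 2 then show ?thesis
      using triple_sum_delta_same_triple[OF st12, of P S] assms by (simp add: triple_sum_swap12[of P])
  next
    case 3 then show ?thesis
      using triple_sum_delta_same_triple[OF st13, of Q P] assms by (simp add: triple_sum_swap13[of P])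
  next
    case 4 then show ?thesis using triple_sum_cofib_same_triple[OF st] by blast
  next
    case 5 then show ?thesis
      using triple_sum_cofib_same_triple[OF st12, of P S] by (simp add: triple_sum_swap12[of P])
  next
    case 6 then show ?thesis
      using triple_sum_cofib_same_triple[OF st13, of Q P] by (simp add: triple_sum_swap13[of P])
  next
    case 7 then show ?thesis by (rule triple_sum_gram_same_triple[OF st])
  qed
qed

definition class_function :: "('a \<Rightarrow> 'a \<Rightarrow> real) \<Rightarrow> bool" where
  "class_function P \<longleftrightarrow> (\<exists>a b c d. \<forall>w\<in>X. \<forall>x\<in>X.
     P w x = a * cst_fun w x + b * delta w x + c * cofib w x + d * G w x)"

text \<open>
  Extends an invariance from the spanning functions to the span, in the first factor; the other
  two factors are reached through the swapping rules.
\<close>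
lemma triple_sum_linear:
  assumes P: "class_function P" and X: "x \<in> X" "x' \<in> X"
    and eq: "\<And>B. B \<in> {cst_fun, delta, cofib, G} \<Longrightarrow> triple_sum B Q S x y z = triple_sum B Q S x' y' z'"
  shows "triple_sum P Q S x y z = triple_sum P Q S x' y' z'"
proof -
  obtain a b c d where abcd: "\<forall>w\<in>X. \<forall>x\<in>X.
      P w x = a * cst_fun w x + b * delta w x + c * cofib w x + d * G w x"
    using P unfolding class_function_def by (elim exE)
  have "triple_sum P Q S x y z = a * triple_sum cst_fun Q S x y z + b * triple_sum delta Q S x y z +
      c * triple_sum cofib Q S x y z + d * triple_sum G Q S x y z" if "x \<in> X" for x y z
    unfolding triple_sum_def sum_distrib_left sum.distrib[symmetric]
    by (intro sum.cong refl)
      (simp only: abcd[rule_format, OF _ that], simp add: algebra_simps)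
  then show ?thesis
    using eq X by simp
qed

lemma triple_sum_class_function:
  assumes st: "same_triple x y z x' y' z'"
    and P: "class_function P" and Q: "class_function Q" and S: "class_function S"
  shows "triple_sum P Q S x y z = triple_sum P Q S x' y' z'"
proof -
  have X: "x \<in> X" "y \<in> X" "z \<in> X" "x' \<in> X" "y' \<in> X" "z' \<in> X"
    using st by (auto simp: same_triple_def same_type_def)
  have 1: "triple_sum P B C x y z = triple_sum P B C x' y' z'"
    if "B \<in> {cst_fun, delta, cofib, G}" "C \<in> {cst_fun, delta, cofib, G}" for B C
    by (rule triple_sum_linear[OF P X(1,4)]) (rule triple_sum_basis[OF st _ that])
  have 2: "triple_sum P Q C x y z = triple_sum P Q C x' y' z'"
    if "C \<in> {cst_fun, delta, cofib, G}" for C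
    unfolding triple_sum_swap12[of P]
    by (rule triple_sum_linear[OF Q X(2,5)]) (use 1 that in \<open>simp add: triple_sum_swap12[of _ P]\<close>)
  show ?thesis
    unfolding triple_sum_swap13[of P]
    by (rule triple_sum_linear[OF S X(3,6)]) (use 2 in \<open>simp add: triple_sum_swap13[of _ Q P]\<close>)
qed

end


section \<open>Linked designs as linked simplices\<close>

text \<open>
  Incidence is given here as one relation \<open>N\<close> on the union of the fibres. The right-hand side of
  \<open>card_inc_link\<close> puts the given values of \<open>\<sigma>\<close> and \<open>\<tau>\<close> over the common denominator \<open>v\<close>, and \<open>tight\<close>
  is the given value of the number of fibres.
\<close>
locale tight_linked_designs =
  fixes J :: "'i set" and v k l :: nat and Om :: "'i \<Rightarrow> 'a set" and N :: "'a \<Rightarrow> 'a \<Rightarrow> bool"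
  assumes finite_J: "finite J"
    and two_fibres: "2 \<le> card J"
    and finite_fibre: "i \<in> J \<Longrightarrow> finite (Om i)"
    and disjoint_fibres: "\<lbrakk>i \<in> J; j \<in> J; i \<noteq> j\<rbrakk> \<Longrightarrow> Om i \<inter> Om j = {}"
    and card_fibre: "i \<in> J \<Longrightarrow> card (Om i) = v"
    and fibre_nonempty: "0 < v"
    and inc_sym: "N x y \<longleftrightarrow> N y x"
    and inc_fibre: "\<lbrakk>i \<in> J; x \<in> Om i; y \<in> Om i\<rbrakk> \<Longrightarrow> \<not> N x y"
    and card_inc: "\<lbrakk>i \<in> J; j \<in> J; i \<noteq> j; y \<in> Om j\<rbrakk> \<Longrightarrow> card {w \<in> Om i. N w y} = k"
    and card_inc_pair: "\<lbrakk>i \<in> J; j \<in> J; i \<noteq> j; y \<in> Om j; z \<in> Om j; y \<noteq> z\<rbrakk> \<Longrightarrow>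
      card {w \<in> Om i. N w y \<and> N w z} = l"
    and card_inc_link: "\<lbrakk>h \<in> J; i \<in> J; j \<in> J; h \<noteq> i; h \<noteq> j; i \<noteq> j; y \<in> Om i; z \<in> Om j\<rbrakk> \<Longrightarrow>
      real (card {w \<in> Om h. N w y \<and> N w z}) =
        (k\<^sup>2 + (if N y z then real k - real v else real k) * sqrt (real k - real l)) / v"
    and tight: "real (card J) = 1 + (real v - 2) * sqrt (real k * (real v - real k)) /
      ((real v - 2 * real k) * sqrt (real v - 1))"
begin

definition inc :: "'a \<Rightarrow> 'a \<Rightarrow> real" where
  "inc x y = of_bool (N x y)"

definition s :: real where
  "s = sqrt (real k - real l)"

text \<open>
  The minus sign before \<open>inc\<close> is forced: since \<open>\<sigma> - \<tau> = - sqrt (k - l)\<close>, a product of two of the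
  matrices \<open>N - k/v\<close> between distinct fibres is a negative multiple of the third one.
\<close>
definition gram :: "'a \<Rightarrow> 'a \<Rightarrow> real" where
  "gram x y = (if \<exists>i\<in>J. x \<in> Om i \<and> y \<in> Om i then of_bool (x = y) - 1 / v
     else (k / v - inc x y) / s)"

lemma two_indices:
  obtains i j where "i \<in> J" "j \<in> J" "i \<noteq> j"
proof -
  have "\<not> card J \<le> Suc 0" using two_fibres by simp
  then show thesis
    using that unfolding card_le_Suc0_iff_eq[OF finite_J] by blast
qed

text \<open>
  In each degenerate case the fraction in \<open>tight\<close> has numerator or denominator zero, so its value
  is 0, and there would be only one fibre.
\<close>
lemma parameters: "0 < k" "k < v" "2 < v" "v \<noteq> 2 * k"
proof -
  obtain i j where ij: "i \<in> J" "j \<in> J" "i \<noteq> j" by (rule two_indices)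
  have ne: "(real v - 2) * sqrt (real k * (real v - real k)) / ((real v - 2 * real k) * sqrt (real v - 1)) \<noteq> 0"
    using tight two_fibres by linarith
  show "0 < k" using ne by (cases "k = 0") auto
  show "v \<noteq> 2 * k" using ne by auto
  obtain y where y: "y \<in> Om j"
    using card_fibre[OF ij(2)] fibre_nonempty by (metis card.empty ex_in_conv less_irrefl)
  have "k \<le> v"
    using card_inc[OF ij y] card_fibre[OF ij(1)] card_mono[OF finite_fibre[OF ij(1)], of "{w \<in> Om i. N w y}"] by auto
  then show "k < v" using ne by (cases "k = v") auto
  have "v \<noteq> 1" "v \<noteq> 2" using ne by auto
  then show "2 < v" using fibre_nonempty by simp
qed

lemma sum_inc: "\<lbrakk>i \<in> J; j \<in> J; i \<noteq> j; y \<in> Om j\<rbrakk> \<Longrightarrow> (\<Sum>w\<in>Om i. inc w y) = k"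
  using card_inc[of i j y] finite_fibre[of i]
  by (simp add: inc_def sum_of_bool_eq Int_def)

lemma sum_inc_inc:
  assumes "i \<in> J"
  shows "(\<Sum>w\<in>Om i. inc w y * inc w z) = card {w \<in> Om i. N w y \<and> N w z}"
proof -
  have "(\<Sum>w\<in>Om i. inc w y * inc w z) = (\<Sum>w\<in>Om i. of_bool (N w y \<and> N w z))"
    by (intro sum.cong) (auto simp: inc_def)
  then show ?thesis
    using finite_fibre[OF assms] by (simp add: sum_of_bool_eq Int_def)
qed

text \<open>
  Double counting of the pairs \<open>(z, w)\<close> with \<open>w\<close> incident with both \<open>z\<close> and a fixed \<open>y\<close>, where \<open>z\<close>
  runs over the fibre of \<open>y\<close> and \<open>w\<close> over another fibre.
\<close>
lemma design_count: "real k * real k = real k + (real v - 1) * real l"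
proof -
  obtain i j where ij: "i \<in> J" "j \<in> J" "i \<noteq> j" by (rule two_indices)
  obtain y where y: "y \<in> Om j"
    using card_fibre[OF ij(2)] fibre_nonempty by (metis card.empty ex_in_conv less_irrefl)
  have "real k * real k = (\<Sum>w\<in>Om i. inc w y * (\<Sum>z\<in>Om j. inc z w))"
    using ij y by (simp add: sum_inc flip: sum_distrib_right)
  also have "\<dots> = (\<Sum>w\<in>Om i. \<Sum>z\<in>Om j. inc w y * inc w z)"
    by (simp add: sum_distrib_left inc_def inc_sym[of _ w for w])
  also have "\<dots> = (\<Sum>z\<in>Om j. \<Sum>w\<in>Om i. inc w y * inc w z)"
    by (rule sum.swap)
  also have "\<dots> = (\<Sum>z\<in>Om j. if z = y then real k else real l)"
  proof (rule sum.cong[OF refl])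
    fix z assume "z \<in> Om j"
    then show "(\<Sum>w\<in>Om i. inc w y * inc w z) = (if z = y then real k else real l)"
      using card_inc[OF ij y] card_inc_pair[OF ij y, of z] by (auto simp: sum_inc_inc[OF ij(1)])
  qed
  also have "\<dots> = real k + (real v - 1) * real l"
    using y finite_fibre[OF ij(2)] card_fibre[OF ij(2)] parameters
    by (simp add: sum.remove[OF _ y] of_nat_diff)
  finally show ?thesis .
qed

lemma order_eq: "real k - real l = real k * (real v - real k) / (real v - 1)"
  using design_count parameters by (simp add: field_simps)

lemma s_pos: "s > 0"
  unfolding s_def order_eq using parameters by simp

lemma s_square: "s * s = real k - real l"
  using s_pos unfolding s_def by simp

lemma gram_same: "\<lbrakk>i \<in> J; x \<in> Om i; y \<in> Om i\<rbrakk> \<Longrightarrow> gram x y = of_bool (x = y) - 1 / v"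
  by (auto simp: gram_def)

lemma gram_other:
  "\<lbrakk>i \<in> J; j \<in> J; i \<noteq> j; x \<in> Om i; y \<in> Om j\<rbrakk> \<Longrightarrow> gram x y = (k / v - inc x y) / s"
  using disjoint_fibres unfolding gram_def by (smt (verit) disjoint_iff)

lemma gram_commute: "gram x y = gram y x"
  using inc_sym by (auto simp: gram_def inc_def)

text \<open>
  On a single fibre, the Gram matrix is the projection that subtracts the mean.
\<close>
lemma sum_gram_times:
  assumes "i \<in> J" "x \<in> Om i"
  shows "(\<Sum>w\<in>Om i. gram w x * g w) = g x - (\<Sum>w\<in>Om i. g w) / v"
proof -
  have "(\<Sum>w\<in>Om i. gram w x * g w) = (\<Sum>w\<in>Om i. (if w = x then g w else 0) - g w / v)"
    by (intro sum.cong refl) (simp add: gram_same[OF assms(1) _ assms(2)] left_diff_distrib)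
  then show ?thesis
    using assms finite_fibre by (simp add: sum_subtractf sum_divide_distrib)
qed

lemma sum_gram_fibre:
  assumes "i \<in> J" "j \<in> J" "y \<in> Om j"
  shows "(\<Sum>w\<in>Om i. gram w y) = 0"
proof (cases "i = j")
  case True
  then show ?thesis
    using sum_gram_times[of i y "\<lambda>_. 1"] assms card_fibre parameters by simp
next
  case False
  have "(\<Sum>w\<in>Om i. gram w y) = (\<Sum>w\<in>Om i. (k / v - inc w y) / s)"
    by (intro sum.cong refl) (simp add: gram_other[OF assms(1,2) False _ assms(3)])
  also have "\<dots> = (v * (k / v) - k) / s"
    using False assms card_fibre sum_inc by (simp add: sum_subtractf flip: sum_divide_distrib)
  finally show ?thesis using parameters by simp
qed

text \<open>
  If \<open>h\<close> is one of the indices \<open>i\<close>, \<open>j\<close>, one factor is a mean-subtracting projection and the other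
  has mean zero. Otherwise the sum reduces to the number of common neighbours of \<open>x\<close> and \<open>y\<close> in the
  fibre \<open>h\<close>, which is given by the design axioms if \<open>i = j\<close> and by the linking condition if not.
\<close>
lemma sum_gram_gram:
  assumes "h \<in> J" "i \<in> J" "j \<in> J" "x \<in> Om i" "y \<in> Om j"
  shows "(\<Sum>w\<in>Om h. gram w x * gram w y) = gram x y"
proof -
  consider "h = i" | "h = j" | "h \<noteq> i" "h \<noteq> j" by blast
  then show ?thesis
  proof cases
    case 1
    then show ?thesis
      using sum_gram_times[of i x "\<lambda>w. gram w y"] sum_gram_fibre[of i j y] assms by simp
  next
    case 2
    then show ?thesis
      using sum_gram_times[of j y "\<lambda>w. gram w x"] sum_gram_fibre[of j i x] assms
      by (simp add: mult.commute gram_commute)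
  next
    case 3
    have "(\<Sum>w\<in>Om h. gram w x * gram w y) =
        (\<Sum>w\<in>Om h. (k / v * (k / v) - k / v * inc w x - k / v * inc w y + inc w x * inc w y) / (s * s))"
      by (intro sum.cong refl)
         (simp add: gram_other[OF assms(1,2) 3(1) _ assms(4)] gram_other[OF assms(1,3) 3(2) _ assms(5)] algebra_simps)
    also have "\<dots> = (v * (k / v * (k / v)) - k / v * k - k / v * k + card {w \<in> Om h. N w x \<and> N w y}) / (s * s)"
      using sum_inc[OF assms(1,2) 3(1) assms(4)] sum_inc[OF assms(1,3) 3(2) assms(5)] card_fibre[OF assms(1)]
      by (simp add: sum_subtractf sum.distrib sum_inc_inc[OF assms(1)] flip: sum_divide_distrib sum_distrib_left)
    also have "\<dots> = (card {w \<in> Om h. N w x \<and> N w y} - k\<^sup>2 / v) / (s * s)"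
      using parameters by (simp add: field_simps power2_eq_square)
    also have "\<dots> = gram x y"
    proof (cases "i = j")
      case True
      have "real (card {w \<in> Om h. N w x \<and> N w y}) = l + of_bool (x = y) * (real k - real l)"
        using card_inc[OF assms(1,2) 3(1) assms(4)] card_inc_pair[OF assms(1,2) 3(1) assms(4), of y] assms True
        by auto
      moreover have "real l - k\<^sup>2 / v = - (real k - real l) / v"
        using design_count parameters by (simp add: field_simps power2_eq_square)
      ultimately have "real (card {w \<in> Om h. N w x \<and> N w y}) - k\<^sup>2 / v = (of_bool (x = y) - 1 / v) * (s * s)"
        unfolding s_square by (simp add: algebra_simps diff_divide_distrib)
      then show ?thesis
        using gram_same[of i x y] True assms s_pos by simp
    next
      case False
      have "real (card {w \<in> Om h. N w x \<and> N w y}) - k\<^sup>2 / v = (k / v - inc x y) * s"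
        using card_inc_link[OF assms(1-3) 3 False assms(4,5)] parameters
        by (simp add: inc_def s_def field_simps)
      then show ?thesis
        unfolding gram_other[OF assms(2,3) False assms(4,5)] using s_pos by simp
    qed
    finally show ?thesis .
  qed
qed

text \<open>
  As \<open>s = sqrt (k * (v - k)) / sqrt (v - 1)\<close>, the number of fibres is \<open>1 + (v - 2) * s / (v - 2 * k)\<close>.
\<close>
lemma tight_order: "(real (card J) - 1) * (real v - 2 * real k) = (real v - 2) * s"
proof -
  have "s = sqrt (real k * (real v - real k)) / sqrt (real v - 1)"
    unfolding s_def order_eq by (rule real_sqrt_divide)
  then have "real (card J) = 1 + (real v - 2) * s / (real v - 2 * real k)"
    using tight by (simp add: mult.commute)
  moreover have "real v - 2 * real k \<noteq> 0"
    using parameters by linarith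
  ultimately show ?thesis by simp
qed

lemma sum_cubes_same:
  assumes "i \<in> J" "x \<in> Om i"
  shows "(\<Sum>w\<in>Om i. gram w x ^ 3) = (real v - 1) * (real v - 2) / (real v)\<^sup>2"
proof -
  have "(\<Sum>w\<in>Om i. gram w x ^ 3) = gram x x ^ 3 + (\<Sum>w\<in>Om i - {x}. gram w x ^ 3)"
    using assms finite_fibre by (simp add: sum.remove)
  also have "(\<Sum>w\<in>Om i - {x}. gram w x ^ 3) = (\<Sum>w\<in>Om i - {x}. (- 1 / v) ^ 3)"
    using assms by (intro sum.cong refl) (simp add: gram_same)
  also have "\<dots> = (real v - 1) * (- 1 / v) ^ 3"
    using assms finite_fibre card_fibre parameters by (simp add: of_nat_diff)
  also have "gram x x ^ 3 + (real v - 1) * (- 1 / v) ^ 3 = (real v - 1) * (real v - 2) / (real v)\<^sup>2"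
    using parameters
    by (simp add: gram_same[OF assms(1,2,2)] field_simps power3_eq_cube power2_eq_square)
  finally show ?thesis .
qed

lemma sum_cubes_other:
  assumes "i \<in> J" "j \<in> J" "i \<noteq> j" "x \<in> Om j"
  shows "(\<Sum>w\<in>Om i. gram w x ^ 3) = - (real v - 1) * (real v - 2 * real k) / ((real v)\<^sup>2 * s)"
proof -
  have "(\<Sum>w\<in>Om i. gram w x ^ 3) =
      (\<Sum>w\<in>Om i. ((k / v) ^ 3 + ((k / v - 1) ^ 3 - (k / v) ^ 3) * inc w x) / s ^ 3)"
    by (intro sum.cong refl) (simp add: gram_other[OF assms(1-3) _ assms(4)] inc_def power_divide)
  also have "\<dots> = (v * (k / v) ^ 3 + ((k / v - 1) ^ 3 - (k / v) ^ 3) * k) / s ^ 3"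
    using sum_inc[OF assms] card_fibre[OF assms(1)]
    by (simp add: sum.distrib flip: sum_divide_distrib sum_distrib_left)
  also have "v * (k / v) ^ 3 + ((k / v - 1) ^ 3 - (k / v) ^ 3) * k =
      - (real k * (real v - real k)) * (real v - 2 * real k) / (real v)\<^sup>2"
    using parameters by (simp add: field_simps power3_eq_cube power2_eq_square)
  also have "real k * (real v - real k) = (real v - 1) * (s * s)"
    unfolding s_square order_eq using parameters by simp
  also have "- ((real v - 1) * (s * s)) * (real v - 2 * real k) / (real v)\<^sup>2 / s ^ 3 =
      - (real v - 1) * (real v - 2 * real k) / ((real v)\<^sup>2 * s)"
    using s_pos parameters by (simp add: divide_simps power3_eq_cube, simp add: algebra_simps)
  finally show ?thesis .
qed

text \<open>
  Already the sum over \<open>y\<close> vanishes for every \<open>x\<close>: by \<open>tight_order\<close>, the contribution of the fibre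
  of \<open>x\<close> cancels against the \<open>card J - 1\<close> equal contributions of the other fibres.
\<close>
lemma sum_cubes: "(\<Sum>x\<in>(\<Union>i\<in>J. Om i). \<Sum>y\<in>(\<Union>i\<in>J. Om i). gram x y ^ 3) = 0"
proof (rule sum.neutral, intro ballI)
  fix x assume "x \<in> (\<Union>i\<in>J. Om i)"
  then obtain i where i: "i \<in> J" "x \<in> Om i" by blast
  have "(\<Sum>y\<in>(\<Union>i\<in>J. Om i). gram x y ^ 3) = (\<Sum>j\<in>J. \<Sum>y\<in>Om j. gram y x ^ 3)"
    unfolding gram_commute[of x]
    by (rule sum.UNION_disjoint[OF finite_J]) (use finite_fibre disjoint_fibres in auto)
  also have "\<dots> = (\<Sum>y\<in>Om i. gram y x ^ 3) + (\<Sum>j\<in>J - {i}. \<Sum>y\<in>Om j. gram y x ^ 3)"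
    by (rule sum.remove[OF finite_J i(1)])
  also have "(\<Sum>j\<in>J - {i}. \<Sum>y\<in>Om j. gram y x ^ 3) =
      (\<Sum>j\<in>J - {i}. - (real v - 1) * (real v - 2 * real k) / ((real v)\<^sup>2 * s))"
    by (intro sum.cong refl sum_cubes_other[OF _ i(1) _ i(2)]) auto
  also have "\<dots> = - (real v - 1) * ((real (card J) - 1) * (real v - 2 * real k)) / ((real v)\<^sup>2 * s)"
    using finite_J i two_fibres by (simp add: of_nat_diff)
  also have "\<dots> = - ((real v - 1) * (real v - 2) / (real v)\<^sup>2)"
    unfolding tight_order using s_pos parameters by (simp add: divide_simps, simp add: algebra_simps)
  finally show "(\<Sum>y\<in>(\<Union>i\<in>J. Om i). gram x y ^ 3) = 0"
    by (simp add: sum_cubes_same[OF i])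
qed

sublocale linked_frames J v Om gram
  by unfold_locales
     (fact finite_J finite_fibre disjoint_fibres card_fibre gram_commute
           sum_gram_fibre sum_gram_gram sum_cubes)+

definition scheme_class :: "nat \<Rightarrow> 'a \<Rightarrow> 'a \<Rightarrow> bool" where
  "scheme_class m x y \<longleftrightarrow>
     (if m = 0 then x = y else if m = 1 then N x y
      else if m = 2 then cofibre x y \<and> x \<noteq> y else \<not> cofibre x y \<and> \<not> N x y)"

lemma inc_cofibre: "N x y \<Longrightarrow> \<not> cofibre x y"
  using inc_fibre unfolding cofibre_def by blast

lemma cofibre_refl: "x \<in> X \<Longrightarrow> cofibre x x"
  unfolding cofibre_def by blast

lemma gram_cases:
  "gram x y = (if cofibre x y then of_bool (x = y) - 1 / v else (k / v - inc x y) / s)"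
  unfolding gram_def cofibre_def ..

text \<open>
  Solving the definition of \<open>gram\<close> for the incidence relation writes it in terms of the four
  spanning functions; the other classes follow, since they are combinations of it, the diagonal
  and the same-fibre indicator.
\<close>
lemma class_function_scheme_class: "class_function (\<lambda>x y. of_bool (scheme_class m x y))"
proof -
  \<comment> \<open>the terms with factor \<open>s\<close> cancel on a common fibre, where \<open>gram\<close> is the diagonal minus \<open>1 / v\<close>\<close>
  have inc: "of_bool (N w x) = k / v * cst_fun w x + s * delta w x + (- k / v - s / v) * cofib w x + (- s) * gram w x"
    if "x \<in> X" for w x
    using cofibre_refl[OF that] inc_cofibre[of w x] s_pos
    by (auto simp: gram_cases cst_fun_def delta_def cofib_def inc_def field_simps)
  consider "m = 0" | "m = 1" | "m = 2" | "m \<noteq> 0" "m \<noteq> 1" "m \<noteq> 2" by blast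
  then show ?thesis
  proof cases
    case 1
    have "\<forall>w\<in>X. \<forall>x\<in>X. of_bool (scheme_class m w x) = 0 * cst_fun w x + 1 * delta w x + 0 * cofib w x + 0 * gram w x"
      by (simp add: 1 scheme_class_def delta_def)
    then show ?thesis unfolding class_function_def by (intro exI)
  next
    case 2
    have "\<forall>w\<in>X. \<forall>x\<in>X. of_bool (scheme_class m w x) =
        k / v * cst_fun w x + s * delta w x + (- k / v - s / v) * cofib w x + (- s) * gram w x"
      using inc by (simp add: 2 scheme_class_def)
    then show ?thesis unfolding class_function_def by (intro exI)
  next
    case 3
    have "of_bool (scheme_class m w x) = 0 * cst_fun w x + (- 1) * delta w x + 1 * cofib w x + 0 * gram w x"
      if "x \<in> X" for w x
      using cofibre_refl[OF that] by (auto simp: 3 scheme_class_def delta_def cofib_def)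
    then have "\<forall>w\<in>X. \<forall>x\<in>X. of_bool (scheme_class m w x) =
        0 * cst_fun w x + (- 1) * delta w x + 1 * cofib w x + 0 * gram w x"
      by blast
    then show ?thesis unfolding class_function_def by (intro exI)
  next
    case 4
    have "of_bool (scheme_class m w x) = (1 - k / v) * cst_fun w x + (- s) * delta w x + (- 1 + k / v + s / v) * cofib w x + s * gram w x"
      if "x \<in> X" for w x
    proof -
      have "of_bool (scheme_class m w x) = cst_fun w x - cofib w x - of_bool (N w x)"
        using inc_cofibre[of w x] 4 by (auto simp: scheme_class_def cst_fun_def cofib_def)
      then show ?thesis
        unfolding inc[OF that] by (simp add: algebra_simps)
    qed
    then have "\<forall>w\<in>X. \<forall>x\<in>X. of_bool (scheme_class m w x) =
        (1 - k / v) * cst_fun w x + (- s) * delta w x + (- 1 + k / v + s / v) * cofib w x + s * gram w x"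
      by blast
    then show ?thesis unfolding class_function_def by (intro exI)
  qed
qed

lemma same_type_scheme_class:
  assumes "scheme_class m x y" "scheme_class m x' y'" "x \<in> X" "y \<in> X" "x' \<in> X" "y' \<in> X"
  shows "same_type x y x' y'"
proof -
  have "x = y \<longleftrightarrow> x' = y'" "cofibre x y \<longleftrightarrow> cofibre x' y'" "N x y \<longleftrightarrow> N x' y'"
    using assms inc_cofibre cofibre_refl unfolding scheme_class_def by (metis)+
  then show ?thesis
    using assms unfolding same_type_def by (simp add: gram_cases inc_def)
qed

lemma scheme_class_sym: "scheme_class m x y \<longleftrightarrow> scheme_class m y x"
  unfolding scheme_class_def inc_sym[of x y] cofibre_sym[of x y] by auto

lemma card_triple:
  "real (card {w \<in> X. scheme_class m w x \<and> scheme_class n w y \<and> scheme_class p w z}) =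
     triple_sum (\<lambda>x y. of_bool (scheme_class m x y)) (\<lambda>x y. of_bool (scheme_class n x y)) (\<lambda>x y. of_bool (scheme_class p x y)) x y z"
proof -
  have "triple_sum (\<lambda>x y. of_bool (scheme_class m x y)) (\<lambda>x y. of_bool (scheme_class n x y)) (\<lambda>x y. of_bool (scheme_class p x y)) x y z
      = (\<Sum>w\<in>X. of_bool (scheme_class m w x \<and> scheme_class n w y \<and> scheme_class p w z))"
    unfolding triple_sum_def by (intro sum.cong) auto
  then show ?thesis
    using finite_X by (simp add: sum_of_bool_eq Int_def)
qed

lemma card_triple_eq:
  assumes "same_triple x y z x' y' z'"
  shows "card {w \<in> X. scheme_class m w x \<and> scheme_class n w y \<and> scheme_class p w z} =
    card {w \<in> X. scheme_class m w x' \<and> scheme_class n w y' \<and> scheme_class p w z'}"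
proof -
  have "real (card {w \<in> X. scheme_class m w x \<and> scheme_class n w y \<and> scheme_class p w z}) =
    real (card {w \<in> X. scheme_class m w x' \<and> scheme_class n w y' \<and> scheme_class p w z'})"
    unfolding card_triple
    by (rule triple_sum_class_function[OF assms class_function_scheme_class class_function_scheme_class class_function_scheme_class])
  then show ?thesis by simp
qed

lemma scheme_class_exhaust: "\<exists>m\<le>3. scheme_class m x y"
proof -
  have "scheme_class 0 x y \<or> scheme_class 1 x y \<or> scheme_class 2 x y \<or> scheme_class 3 x y"
    by (auto simp: scheme_class_def)
  moreover have "(0::nat) \<le> 3" "(1::nat) \<le> 3" "(2::nat) \<le> 3" "(3::nat) \<le> 3" by simp_all
  ultimately show ?thesis by blast
qed

lemma scheme_class_unique:
  assumes "scheme_class m x y" "scheme_class m' x y" "m \<le> 3" "m' \<le> 3" "x \<in> X"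
  shows "m = m'"
proof -
  have "m \<in> {0, 1, 2, 3}" "m' \<in> {0, 1, 2, 3}" using assms(3,4) by auto
  then show ?thesis
    using assms(1,2) inc_cofibre[of x y] cofibre_refl[OF assms(5)]
    by (auto simp: scheme_class_def)
qed

text \<open>
  A point \<open>y\<close> has \<open>k\<close> neighbours in another fibre, where \<open>0 < k < v\<close>, and its own fibre contains
  further points.
\<close>
lemma scheme_class_nonempty:
  assumes "m \<le> 3"
  shows "\<exists>x\<in>X. \<exists>y\<in>X. scheme_class m x y"
proof -
  obtain i j where ij: "i \<in> J" "j \<in> J" "i \<noteq> j" by (rule two_indices)
  obtain y where y: "y \<in> Om j"
    using card_fibre[OF ij(2)] fibre_nonempty by (metis card.empty ex_in_conv less_irrefl)
  have yX: "y \<in> X" using y ij by blast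
  have "{w \<in> Om i. N w y} \<noteq> {}"
    using card_inc[OF ij y] parameters by (metis card.empty less_irrefl)
  then obtain x where x: "x \<in> Om i" "N x y" by blast
  have "{w \<in> Om i. N w y} \<noteq> Om i"
    using card_inc[OF ij y] card_fibre[OF ij(1)] parameters by (metis less_irrefl)
  then obtain x' where x': "x' \<in> Om i" "\<not> N x' y" by blast
  have "Om j - {y} \<noteq> {}"
    using card_fibre[OF ij(2)] parameters y card_Diff_singleton[OF y]
    by (metis One_nat_def card.empty diff_is_0_eq less_numeral_extra(3) not_le numeral_2_eq_2 lessI order.strict_trans)
  then obtain y' where y': "y' \<in> Om j" "y' \<noteq> y" by blast
  have "scheme_class 0 y y" "scheme_class 1 x y" "scheme_class 2 y' y" "scheme_class 3 x' y"
    using x x' y' cofibre_iff[OF ij(2) y] disjoint_fibres[OF ij] y by (auto simp: scheme_class_def)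
  moreover have "x \<in> X" "x' \<in> X" "y' \<in> X" using x x' y' ij by blast+
  moreover have "m = 0 \<or> m = 1 \<or> m = 2 \<or> m = 3" using assms by auto
  ultimately show ?thesis using yX by metis
qed

theorem triply_regular:
  assumes R: "\<And>m. m \<le> 3 \<Longrightarrow> R m = {(x, y). x \<in> X \<and> y \<in> X \<and> scheme_class m x y}"
  shows "triply_regular_scheme X 3 R"
proof -
  have R_iff: "(x, y) \<in> R m \<longleftrightarrow> x \<in> X \<and> y \<in> X \<and> scheme_class m x y" if "m \<le> 3" for m x y
    by (simp add: R[OF that])
  have ne: "R m \<noteq> {}" if "m \<le> 3" for m
    using scheme_class_nonempty[OF that] R_iff[OF that] by (metis empty_iff)
  have uniq: "m = m'" if m: "m \<le> 3" "m' \<le> 3" and meet: "R m \<inter> R m' \<noteq> {}" for m m'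
  proof -
    obtain x y where "(x, y) \<in> R m" "(x, y) \<in> R m'" using meet by fastforce
    then show ?thesis
      using scheme_class_unique[of m x y m'] R_iff m by metis
  qed
  have part: "partition_on (X \<times> X) (R ` {..3})"
  proof (rule partition_onI)
    have "(x, y) \<in> \<Union> (R ` {..3}) \<longleftrightarrow> x \<in> X \<and> y \<in> X" for x y
    proof -
      have "(x, y) \<in> \<Union> (R ` {..3}) \<longleftrightarrow> (\<exists>m\<le>3. (x, y) \<in> R m)"
        by (simp only: UN_iff Bex_def atMost_iff)
      also have "\<dots> \<longleftrightarrow> (\<exists>m\<le>3. x \<in> X \<and> y \<in> X \<and> scheme_class m x y)"
        by (intro ex_cong1 conj_cong refl R_iff)
      also have "\<dots> \<longleftrightarrow> x \<in> X \<and> y \<in> X"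
        by (simp only: ex_simps conj_left_commute[of "m \<le> 3" for m :: nat] scheme_class_exhaust simp_thms)
      finally show ?thesis .
    qed
    then show "\<Union> (R ` {..3}) = X \<times> X"
      by (simp only: set_eq_iff split_paired_All mem_Times_iff fst_conv snd_conv simp_thms)
  next
    fix p q assume "p \<in> R ` {..3}" "q \<in> R ` {..3}" "p \<noteq> q"
    then obtain m m' where "p = R m" "q = R m'" "m \<le> 3" "m' \<le> 3" "m \<noteq> m'" by blast
    then show "disjnt p q"
      unfolding disjnt_def using uniq by blast
  next
    show "{} \<notin> R ` {..3}"
      using ne by blast
  qed
  have inj: "inj_on R {..3}"
    using uniq ne by (intro inj_onI) blast
  have diag: "R 0 = Id_on X"
    unfolding R[OF le0] by (auto simp: scheme_class_def)
  have symR: "sym (R m)" if "m \<le> 3" for m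
    unfolding sym_def R_iff[OF that] using scheme_class_sym by metis
  have swap: "(w, x) \<in> R m \<longleftrightarrow> (x, w) \<in> R m" if "m \<le> 3" for m w x
    using symR[OF that] by (meson symD)
  have type: "same_type x y x' y'" if "m \<le> 3" "(x, y) \<in> R m" "(x', y') \<in> R m" for m x y x' y'
    using that R_iff same_type_scheme_class by metis
  have card_R: "card {w \<in> X. (w, x) \<in> R m \<and> (w, y) \<in> R n \<and> (w, z) \<in> R p} =
      card {w \<in> X. scheme_class m w x \<and> scheme_class n w y \<and> scheme_class p w z}"
    if "m \<le> 3" "n \<le> 3" "p \<le> 3" "x \<in> X" "y \<in> X" "z \<in> X" for m n p x y z
    by (rule arg_cong[where f = card], rule Collect_cong) (use that R_iff in metis)
  have triple: "card {w \<in> X. (w, x) \<in> R m \<and> (w, y) \<in> R n \<and> (w, z) \<in> R p} =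
      card {w \<in> X. (w, x') \<in> R m \<and> (w, y') \<in> R n \<and> (w, z') \<in> R p}"
    if "m \<le> 3" "n \<le> 3" "p \<le> 3" and st: "same_triple x y z x' y' z'" for m n p x y z x' y' z'
  proof -
    have "x \<in> X" "y \<in> X" "z \<in> X" "x' \<in> X" "y' \<in> X" "z' \<in> X"
      using st unfolding same_triple_def same_type_def by blast+
    then show ?thesis
      using card_triple_eq[OF st] card_R that by presburger
  qed
  have intersection: "\<exists>p. \<forall>x y. (x, y) \<in> R c \<longrightarrow> card {w \<in> X. (x, w) \<in> R a \<and> (w, y) \<in> R b} = p"
    if "a \<le> 3" "b \<le> 3" "c \<le> 3" for a b c
  proof -
    \<comment> \<open>the pair count is the triple count for \<open>x\<close>, \<open>y\<close>, \<open>y\<close> in which the condition on \<open>y\<close> is repeated\<close>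
    obtain x0 y0 where 0: "(x0, y0) \<in> R c" using ne[OF \<open>c \<le> 3\<close>] by fastforce
    have "card {w \<in> X. (x, w) \<in> R a \<and> (w, y) \<in> R b} = card {w \<in> X. (x0, w) \<in> R a \<and> (w, y0) \<in> R b}"
      if "(x, y) \<in> R c" for x y
    proof -
      have xy: "same_type x y x0 y0" using type[OF \<open>c \<le> 3\<close> that 0] .
      then have "same_type y y y0 y0"
        unfolding same_type_def[of x y] by (intro type[OF le0]) (simp_all only: diag Id_on_iff simp_thms)
      then have "same_triple x y y x0 y0 y0"
        using xy by (simp add: same_triple_def)
      from triple[OF \<open>a \<le> 3\<close> \<open>b \<le> 3\<close> \<open>b \<le> 3\<close> this] show ?thesis
        by (simp add: swap[OF \<open>a \<le> 3\<close>])
    qed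
    then show ?thesis by blast
  qed
  have triples: "\<exists>c. \<forall>x\<in>X. \<forall>y\<in>X. \<forall>z\<in>X. (x, y) \<in> R i \<longrightarrow> (y, z) \<in> R j \<longrightarrow> (z, x) \<in> R h \<longrightarrow>
      card {w \<in> X. (w, x) \<in> R m \<and> (w, y) \<in> R n \<and> (w, z) \<in> R p} = c"
    if "i \<le> 3" "j \<le> 3" "h \<le> 3" "p \<le> 3" "m \<le> 3" "n \<le> 3" for i j h p m n
  proof (cases "\<exists>x y z. (x, y) \<in> R i \<and> (y, z) \<in> R j \<and> (z, x) \<in> R h")
    case True
    then obtain x0 y0 z0 where 0: "(x0, y0) \<in> R i" "(y0, z0) \<in> R j" "(z0, x0) \<in> R h" by blast
    have "card {w \<in> X. (w, x) \<in> R m \<and> (w, y) \<in> R n \<and> (w, z) \<in> R p} =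
        card {w \<in> X. (w, x0) \<in> R m \<and> (w, y0) \<in> R n \<and> (w, z0) \<in> R p}"
      if "(x, y) \<in> R i" "(y, z) \<in> R j" "(z, x) \<in> R h" for x y z
    proof (rule triple[OF \<open>m \<le> 3\<close> \<open>n \<le> 3\<close> \<open>p \<le> 3\<close>])
      show "same_triple x y z x0 y0 z0"
        unfolding same_triple_def
        using type[OF \<open>i \<le> 3\<close> that(1) 0(1)] type[OF \<open>j \<le> 3\<close> that(2) 0(2)]
          same_type_sym[OF type[OF \<open>h \<le> 3\<close> that(3) 0(3)]] by blast
    qed
    then show ?thesis by blast
  next
    case False
    then show ?thesis by blast
  qed
  show ?thesis
    unfolding triply_regular_scheme_def symmetric_association_scheme_def
    by (intro conjI allI impI finite_X part inj diag symR intersection triples)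
qed

end


section \<open>The association scheme of a linked system\<close>

theorem corollary6p2:
  fixes f v k l :: nat
    and Om :: "nat \<Rightarrow> 'a set"
    and I :: "nat \<Rightarrow> nat \<Rightarrow> ('a \<times> 'a) set"
    and \<sigma> \<tau> :: int
    and n :: real
    and R :: "nat \<Rightarrow> ('a \<times> 'a) set"
  assumes f2: "f \<ge> 2"
    and linked: "linked_system f Om I v k l"
    and n: "n = real k - real l"
    and \<sigma>\<tau>: "\<And>i j h x y. \<lbrakk>i \<in> {1..f}; j \<in> {1..f}; h \<in> {1..f}; i \<noteq> j; j \<noteq> h; i \<noteq> h;
                x \<in> Om i; y \<in> Om j\<rbrakk> \<Longrightarrow>
              int (card {z \<in> Om h. (x, z) \<in> I i h \<and> (y, z) \<in> I j h}) =
                (if (x, y) \<in> I i j then \<sigma> else \<tau>)"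
    and \<sigma>: "real_of_int \<sigma> = 1 / real v * ((real k)^2 - sqrt n * (real v - real k))"
    and \<tau>: "real_of_int \<tau> = real k / real v * (real k + sqrt n)"
    and f: "real f = 1 + ((real v - 2) * sqrt (real k * (real v - real k))) /
                         ((real v - 2 * real k) * sqrt (real v - 1))"
    and R0: "R 0 = {(x, x) | x. x \<in> (\<Union>i\<in>{1..f}. Om i)}"
    and R1: "R 1 = {(x, y). \<exists>i\<in>{1..f}. \<exists>j\<in>{1..f}. i \<noteq> j \<and> x \<in> Om i \<and> y \<in> Om j \<and> (x, y) \<in> I i j}"
    and R2: "R 2 = {(x, y). \<exists>i\<in>{1..f}. x \<in> Om i \<and> y \<in> Om i \<and> x \<noteq> y}"
    and R3: "R 3 = {(x, y). \<exists>i\<in>{1..f}. \<exists>j\<in>{1..f}. i \<noteq> j \<and> x \<in> Om i \<and> y \<in> Om j \<and> (x, y) \<notin> I i j}"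
  shows "triply_regular_scheme (\<Union>i\<in>{1..f}. Om i) 3 R"
proof -
  define N where "N = (\<lambda>x y. (x, y) \<in> R 1)"
  have design: "symmetric_design (Om i) (Om j) (I i j) v k l"
    and disjoint: "Om i \<inter> Om j = {}" and converse: "I j i = (I i j)\<inverse>"
    if "i \<in> {1..f}" "j \<in> {1..f}" "i \<noteq> j" for i j
    using linked that unfolding linked_system_def by blast+
  have fibre: "finite (Om i)" "card (Om i) = v" "0 < v" if i: "i \<in> {1..f}" for i
  proof -
    have "\<exists>j\<in>{1..f}. i \<noteq> j"
      using f2 by (intro bexI[of _ "if i = 1 then 2 else 1"]) auto
    then obtain j where "j \<in> {1..f}" "i \<noteq> j" by blast
    then have "finite (Om i)" "card (Om i) = v" "Om i \<noteq> {}"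
      using design[OF i] unfolding symmetric_design_def by blast+
    then show "finite (Om i)" "card (Om i) = v" "0 < v"
      by (auto simp: card_gt_0_iff)
  qed
  have N_iff: "N x y \<longleftrightarrow> (x, y) \<in> I i j"
    if "i \<in> {1..f}" "j \<in> {1..f}" "i \<noteq> j" "x \<in> Om i" "y \<in> Om j" for i j x y
  proof
    assume "N x y"
    then obtain i' j' where ij': "i' \<in> {1..f}" "j' \<in> {1..f}" "x \<in> Om i'" "y \<in> Om j'" "(x, y) \<in> I i' j'"
      unfolding N_def R1 by blast
    then have "i' = i" "j' = j" using disjoint that by blast+
    then show "(x, y) \<in> I i j" using ij' by simp
  next
    assume "(x, y) \<in> I i j"
    then show "N x y" unfolding N_def R1 using that by blast
  qed
  have N_sym: "N y x" if "N x y" for x y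
  proof -
    obtain i j where ij: "i \<in> {1..f}" "j \<in> {1..f}" "i \<noteq> j" "x \<in> Om i" "y \<in> Om j" "(x, y) \<in> I i j"
      using \<open>N x y\<close> unfolding N_def R1 by blast
    then have "(y, x) \<in> I j i" using converse[OF ij(1-3)] by simp
    then show "N y x" using N_iff[OF ij(2,1) ij(3)[symmetric] ij(5,4)] by simp
  qed
  have "real k ^ 2 - sqrt n * (real v - real k) = real k ^ 2 + (real k - real v) * sqrt n"
    by (simp add: algebra_simps)
  then have \<sigma>': "real_of_int \<sigma> = (real k ^ 2 + (real k - real v) * sqrt n) / v"
    unfolding \<sigma> by simp
  have \<tau>': "real_of_int \<tau> = (real k ^ 2 + real k * sqrt n) / v"
    unfolding \<tau> by (simp add: distrib_left add_divide_distrib power2_eq_square)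
  \<comment> \<open>\<open>card_inc\<close> counts the points on a block; \<open>card_inc_pair\<close> needs the transposed design, whose blocks are the points\<close>
  interpret T: tight_linked_designs "{1..f}" v k l Om N
  proof unfold_locales
    show "finite {1..f}" "2 \<le> card {1..f}" using f2 by simp_all
    show "finite (Om i)" "card (Om i) = v" if "i \<in> {1..f}" for i using fibre[OF that] by blast+
    show "0 < v" using fibre[of 1] f2 by simp
    show "Om i \<inter> Om j = {}" if "i \<in> {1..f}" "j \<in> {1..f}" "i \<noteq> j" for i j using disjoint[OF that] .
    show "N x y \<longleftrightarrow> N y x" for x y using N_sym by blast
    show "\<not> N x y" if "i \<in> {1..f}" "x \<in> Om i" "y \<in> Om i" for i x y
      using that disjoint unfolding N_def R1 by blast
    show "card {w \<in> Om i. N w y} = k" if ij: "i \<in> {1..f}" "j \<in> {1..f}" "i \<noteq> j" "y \<in> Om j" for i j y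
    proof -
      have "{w \<in> Om i. N w y} = {w \<in> Om i. (w, y) \<in> I i j}"
        using N_iff[OF ij(1-3) _ ij(4)] by blast
      then show ?thesis
        using design[OF ij(1-3)] ij(4) unfolding symmetric_design_def by simp
    qed
    show "card {w \<in> Om i. N w y \<and> N w z} = l"
      if ij: "i \<in> {1..f}" "j \<in> {1..f}" "i \<noteq> j" "y \<in> Om j" "z \<in> Om j" "y \<noteq> z" for i j y z
    proof -
      have "{w \<in> Om i. N w y \<and> N w z} = {w \<in> Om i. (y, w) \<in> I j i \<and> (z, w) \<in> I j i}"
        using N_iff[OF ij(2,1) ij(3)[symmetric] ij(4)] N_iff[OF ij(2,1) ij(3)[symmetric] ij(5)] N_sym by blast
      then show ?thesis
        using design[OF ij(2,1) ij(3)[symmetric]] ij(4-6) unfolding symmetric_design_def by simp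
    qed
    show "real (card {w \<in> Om h. N w y \<and> N w z}) =
        (k\<^sup>2 + (if N y z then real k - real v else real k) * sqrt (real k - real l)) / v"
      if ij: "h \<in> {1..f}" "i \<in> {1..f}" "j \<in> {1..f}" "h \<noteq> i" "h \<noteq> j" "i \<noteq> j" "y \<in> Om i" "z \<in> Om j"
      for h i j y z
    proof -
      have "{w \<in> Om h. N w y \<and> N w z} = {w \<in> Om h. (y, w) \<in> I i h \<and> (z, w) \<in> I j h}"
        using N_iff[OF ij(2,1) ij(4)[symmetric] ij(7)] N_iff[OF ij(3,1) ij(5)[symmetric] ij(8)] N_sym by blast
      then have "int (card {w \<in> Om h. N w y \<and> N w z}) = (if N y z then \<sigma> else \<tau>)"
        unfolding N_iff[OF ij(2,3,6-8)]
        by (simp only: \<sigma>\<tau>[OF ij(2,3,1,6) ij(5)[symmetric] ij(4)[symmetric] ij(7,8)])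
      from arg_cong[OF this, of real_of_int]
      have "real (card {w \<in> Om h. N w y \<and> N w z}) = real_of_int (if N y z then \<sigma> else \<tau>)"
        by (simp only: of_int_of_nat_eq)
      then show ?thesis
        unfolding n[symmetric] using \<sigma>' \<tau>' by simp
    qed
    show "real (card {1..f}) = 1 + (real v - 2) * sqrt (real k * (real v - real k)) /
        ((real v - 2 * real k) * sqrt (real v - 1))"
      using f by simp
  qed
  show ?thesis
  proof (rule T.triply_regular)
    fix m :: nat assume "m \<le> 3"
    have N_X: "N x y \<Longrightarrow> x \<in> T.X \<and> y \<in> T.X" for x y
      unfolding N_def R1 by blast
    have classes: "R 0 = {(x, y). x \<in> T.X \<and> y \<in> T.X \<and> x = y}"
      "R 1 = {(x, y). x \<in> T.X \<and> y \<in> T.X \<and> N x y}"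
      "R 2 = {(x, y). x \<in> T.X \<and> y \<in> T.X \<and> T.cofibre x y \<and> x \<noteq> y}"
      "R 3 = {(x, y). x \<in> T.X \<and> y \<in> T.X \<and> \<not> T.cofibre x y \<and> \<not> N x y}"
    proof -
      show "R 0 = {(x, y). x \<in> T.X \<and> y \<in> T.X \<and> x = y}" unfolding R0 by blast
      show "R 1 = {(x, y). x \<in> T.X \<and> y \<in> T.X \<and> N x y}" using N_X unfolding N_def by blast
      show "R 2 = {(x, y). x \<in> T.X \<and> y \<in> T.X \<and> T.cofibre x y \<and> x \<noteq> y}"
        unfolding R2 T.cofibre_def by blast
      have "(\<exists>i\<in>{1..f}. \<exists>j\<in>{1..f}. i \<noteq> j \<and> x \<in> Om i \<and> y \<in> Om j \<and> (x, y) \<notin> I i j) \<longleftrightarrow>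
          x \<in> T.X \<and> y \<in> T.X \<and> \<not> T.cofibre x y \<and> \<not> N x y" (is "?L \<longleftrightarrow> ?R") for x y
      proof
        assume ?L
        then obtain i j where ij: "i \<in> {1..f}" "j \<in> {1..f}" "i \<noteq> j" "x \<in> Om i" "y \<in> Om j" "(x, y) \<notin> I i j"
          by blast
        have "\<not> T.cofibre x y"
          using T.cofibre_iff[OF ij(2,5), of x] disjoint[OF ij(1-3)] ij(4) by blast
        then show ?R using ij N_iff[OF ij(1-5)] by blast
      next
        assume ?R
        then obtain i j where ij: "i \<in> {1..f}" "j \<in> {1..f}" "x \<in> Om i" "y \<in> Om j" by blast
        have "i \<noteq> j" using \<open>?R\<close> ij unfolding T.cofibre_def by blast
        then show ?L using N_iff[OF ij(1,2) _ ij(3,4)] ij \<open>?R\<close> by blast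
      qed
      then show "R 3 = {(x, y). x \<in> T.X \<and> y \<in> T.X \<and> \<not> T.cofibre x y \<and> \<not> N x y}"
        unfolding R3 by (simp only:)
    qed
    have "m = 0 \<or> m = 1 \<or> m = 2 \<or> m = 3" using \<open>m \<le> 3\<close> by auto
    then show "R m = {(x, y). x \<in> T.X \<and> y \<in> T.X \<and> T.scheme_class m x y}"
      by (elim disjE) (simp_all add: classes T.scheme_class_def del: UN_iff One_nat_def)
  qed
qed

end
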